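(* Let $d\ge2$ and let $q$ be a prime power with $q\equiv1\pmod d$. Then every near-linear orthomorphism $\theta\in\mathscr{D}_d(q)$ is orthogonal to precisely $(q-3d-1)/d$ linear orthomorphisms over $\mathbb{F}_q$.
   Context: Let $\mathbb{F}_q$ be the finite field of order $q$. An orthomorphism is a permutation $\theta$ of $\mathbb{F}_q$ such that $x\mapsto\theta(x)-x$ is also a permutation. Two orthomorphisms $\theta,\theta'$ are orthogonal if $x\mapsto\theta(x)-\theta'(x)$ is a permutation. For $k\mid(q-1)$, fix a generator $g$ of $\mathbb{F}_q^*$ and let $C_{k,i}=\{g^j: j\equiv i\pmod k\}$, $0\le i<k$. A cyclotomic map of index $k$ with multipliers $[a_0,\dots,a_{k-1}]$ is $\theta(0)=0$, $\theta(x)=a_ix$ for $x\in C_{k,i}$. $\mathscr{C}_k(q)$ is the set of orthomorphisms that are cyclotomic maps of index $k$, and $\mathscr{D}_k(q)=\mathscr{C}_k(q)\setminus\bigcup_{\ell<k,\ \ell\mid(q-1)}\mathscr{C}_\ell(q)$. A linear orthomorphism is an element of $\mathscr{C}_1(q)$, i.e. a map $x\mapsto cx$ with $c\in\mathbb{F}_q\setminus\{0,1\}$. An element of $\mathscr{C}_k(q)$ with multipliers $[a_0,\dots,a_{k-1}]$ is near-linear if $a_0\neq a_1=\cdots=a_{k-1}$. *)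

theory Defs
  imports Complex_Main "HOL-Number_Theory.Cong" "HOL-Library.Cardinality"
begin

text \<open>The field of order \<open>q\<close> is a type \<open>'a\<close> of sort \<open>{field, finite}\<close> with \<open>CARD('a) = q\<close>.\<close>

definition orthomorphism :: "('a::{field,finite} \<Rightarrow> 'a) \<Rightarrow> bool" where
  "orthomorphism \<theta> \<longleftrightarrow> bij \<theta> \<and> bij (\<lambda>x. \<theta> x - x)"

definition orthogonal_orthos :: "('a::{field,finite} \<Rightarrow> 'a) \<Rightarrow> ('a \<Rightarrow> 'a) \<Rightarrow> bool" where
  "orthogonal_orthos \<theta> \<theta>' \<longleftrightarrow>
     orthomorphism \<theta> \<and> orthomorphism \<theta>' \<and> bij (\<lambda>x. \<theta> x - \<theta>' x)"

definition mult_generator :: "'a::{field,finite} \<Rightarrow> bool" where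
  "mult_generator g \<longleftrightarrow> range (\<lambda>j::nat. g ^ j) = UNIV - {0}"

text \<open>Natural exponents suffice: \<open>g\<close> has order \<open>CARD('a) - 1\<close>, a multiple of \<open>k\<close>
  whenever these classes are used.\<close>

definition cyclotomic_class :: "'a::{field,finite} \<Rightarrow> nat \<Rightarrow> nat \<Rightarrow> 'a set" where
  "cyclotomic_class g k i = {g ^ j | j::nat. [j = i] (mod k)}"

text \<open>\<open>\<theta>\<close> is the cyclotomic map of index \<open>k\<close> with multipliers \<open>[a 0, \<dots>, a (k - 1)]\<close>;
  the values \<open>a i\<close> for \<open>i \<ge> k\<close> are irrelevant.\<close>

definition is_cyclotomic_map ::
  "'a::{field,finite} \<Rightarrow> nat \<Rightarrow> (nat \<Rightarrow> 'a) \<Rightarrow> ('a \<Rightarrow> 'a) \<Rightarrow> bool" where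
  "is_cyclotomic_map g k a \<theta> \<longleftrightarrow>
     \<theta> 0 = 0 \<and> (\<forall>i<k. \<forall>x\<in>cyclotomic_class g k i. \<theta> x = a i * x)"

definition cyc_orthos :: "'a::{field,finite} \<Rightarrow> nat \<Rightarrow> ('a \<Rightarrow> 'a) set" where
  "cyc_orthos g k = {\<theta>. orthomorphism \<theta> \<and> (\<exists>a. is_cyclotomic_map g k a \<theta>)}"

definition primitive_cyc_orthos :: "'a::{field,finite} \<Rightarrow> nat \<Rightarrow> ('a \<Rightarrow> 'a) set" where
  "primitive_cyc_orthos g k =
     cyc_orthos g k - (\<Union>l\<in>{l. l < k \<and> l dvd CARD('a) - 1}. cyc_orthos g l)"

definition linear_orthos :: "'a::{field,finite} \<Rightarrow> ('a \<Rightarrow> 'a) set" where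
  "linear_orthos g = cyc_orthos g 1"

text \<open>The condition \<open>2 \<le> k\<close> is what gives the multiplier \<open>a 1\<close> a meaning.\<close>

definition near_linear :: "'a::{field,finite} \<Rightarrow> nat \<Rightarrow> ('a \<Rightarrow> 'a) \<Rightarrow> bool" where
  "near_linear g k \<theta> \<longleftrightarrow> 2 \<le> k \<and> \<theta> \<in> cyc_orthos g k \<and>
     (\<exists>a. is_cyclotomic_map g k a \<theta> \<and> a 0 \<noteq> a 1 \<and> (\<forall>i\<in>{1..<k}. a i = a 1))"

end

theory Submission imports Defs "HOL-Library.FuncSet" begin

text \<open>Write \<open>H\<close> for the group of \<open>d\<close>-th powers, which has order \<open>(q - 1) / d\<close>, and let \<open>\<theta>\<close> multiply
  by \<open>a\<close> on \<open>H\<close> and by \<open>b\<close> off \<open>H\<close>. Then \<open>x \<mapsto> \<theta> x - c x\<close> is a permutation exactly when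
  \<open>(a - c) / (b - c) \<in> H\<close>. The Moebius map \<open>c \<mapsto> (a - c) / (b - c)\<close> is a bijection from the field
  without \<open>b\<close> to the field without \<open>1\<close>, so this holds for \<open>(q - 1) / d - 1\<close> values of \<open>c\<close>. Two of
  them are \<open>0\<close> and \<open>1\<close>, because \<open>\<theta>\<close> is an orthomorphism, and these are exactly the multipliers that
  do not give linear orthomorphisms.\<close>

section \<open>Powers of a generator and the size of the class of index 0\<close>

lemma finite_field_power_card_minus_1:
  fixes x :: "'a::{field,finite}"
  assumes "x \<noteq> 0"
  shows "x ^ (CARD('a) - 1) = 1"
proof -
  let ?U = "UNIV - {0::'a}"
  \<comment> \<open>Multiplying by \<open>x\<close> only permutes the factors of the product of all
    nonzero elements; that product is nonzero and cancels.\<close>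
  have "bij_betw (\<lambda>y. x * y) ?U ?U"
    using assms by (intro bij_betwI[where g = "\<lambda>y. y / x"]) auto
  then have "\<Prod>?U = (\<Prod>y\<in>?U. x * y)"
    by (rule prod.reindex_bij_betw[symmetric])
  also have "\<dots> = x ^ (CARD('a) - 1) * \<Prod>?U"
    by (simp add: prod.distrib card_Diff_singleton)
  finally show ?thesis
    by simp
qed

lemma mult_generator_nonzero:
  assumes "mult_generator g"
  shows "g \<noteq> 0"
proof -
  have "g ^ 1 \<in> UNIV - {0}"
    using assms unfolding mult_generator_def by blast
  then show ?thesis
    by simp
qed

lemma mult_generator_power_mod:
  fixes g :: "'a::{field,finite}"
  assumes "mult_generator g"
  shows "g ^ (j mod (CARD('a) - 1)) = g ^ j"
proof -
  let ?m = "CARD('a) - 1"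
  have "g ^ j = g ^ (?m * (j div ?m) + j mod ?m)"
    by simp
  also have "\<dots> = g ^ (j mod ?m)"
    unfolding power_add power_mult
    by (simp only: finite_field_power_card_minus_1[OF mult_generator_nonzero[OF assms]] power_one mult_1)
  finally show ?thesis
    by simp
qed

lemma finite_field_card_minus_1_pos: "0 < CARD('a::{field,finite}) - 1"
proof -
  have "card {0, 1::'a} \<le> CARD('a)"
    by (intro card_mono) auto
  then show ?thesis
    by simp
qed

text \<open>Exponents reduced modulo \<open>CARD('a) - 1\<close> already reach every nonzero
  element, and there are exactly as many such exponents as nonzero elements.\<close>

lemma inj_on_mult_generator_power:
  fixes g :: "'a::{field,finite}"
  assumes "mult_generator g"
  shows "inj_on (\<lambda>j. g ^ j) {..<CARD('a) - 1}"
proof (rule eq_card_imp_inj_on)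
  have "(\<lambda>j. g ^ j) ` {..<CARD('a) - 1} = range (\<lambda>j. g ^ j)"
  proof (intro equalityI subsetI)
    fix x assume "x \<in> range (\<lambda>j. g ^ j)"
    then obtain j where "x = g ^ j"
      by blast
    then have "x = g ^ (j mod (CARD('a) - 1))"
      by (simp only: mult_generator_power_mod[OF assms])
    then show "x \<in> (\<lambda>j. g ^ j) ` {..<CARD('a) - 1}"
      using finite_field_card_minus_1_pos[where 'a = 'a] by auto
  qed auto
  then show "card ((\<lambda>j. g ^ j) ` {..<CARD('a) - 1}) = card {..<CARD('a) - 1}"
    using assms unfolding mult_generator_def by (simp add: card_Diff_singleton)
qed simp

lemma cyclotomic_class_0: "cyclotomic_class g k 0 = range (\<lambda>i. (g ^ k) ^ i)"
  by (auto simp: cyclotomic_class_def cong_0_iff simp flip: power_mult)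

text \<open>Reducing \<open>i\<close> modulo \<open>n\<close> leaves \<open>g ^ (k * i)\<close>
  unchanged, and for \<open>i < n\<close> the exponents \<open>k * i\<close> stay below
  \<open>CARD('a) - 1\<close>, where powers of \<open>g\<close> are distinct.\<close>

lemma card_cyclotomic_class_0:
  fixes g :: "'a::{field,finite}"
  assumes "mult_generator g" "CARD('a) - 1 = k * n"
  shows "card (cyclotomic_class g k 0) = n"
proof -
  have pos: "0 < k * n"
    using finite_field_card_minus_1_pos[where 'a = 'a] assms(2) by metis
  have "cyclotomic_class g k 0 = (\<lambda>j. g ^ j) ` (\<lambda>i. k * i) ` {..<n}"
  proof (intro equalityI subsetI)
    fix x assume "x \<in> cyclotomic_class g k 0"
    then obtain i where "x = g ^ (k * i)"
      by (auto simp: cyclotomic_class_0 power_mult)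
    also have "\<dots> = g ^ (k * (i mod n))"
      using mult_generator_power_mod[OF assms(1), of "k * i"] by (simp only: assms(2) mult_mod_right)
    finally show "x \<in> (\<lambda>j. g ^ j) ` (\<lambda>i. k * i) ` {..<n}"
      using pos by auto
  qed (auto simp: cyclotomic_class_0 power_mult)
  also have "card \<dots> = card ((\<lambda>i. k * i) ` {..<n})"
    using pos assms(2)
    by (intro card_image inj_on_subset[OF inj_on_mult_generator_power[OF assms(1)]]) auto
  also have "\<dots> = n"
    using pos by (subst card_image) (auto simp: inj_on_def)
  finally show ?thesis .
qed

lemma cyclotomic_class_0_mult_closed:
  "x \<in> cyclotomic_class g k 0 \<Longrightarrow> y \<in> cyclotomic_class g k 0 \<Longrightarrow> x * y \<in> cyclotomic_class g k 0"
  unfolding cyclotomic_class_0 by (auto simp flip: power_add)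

lemma one_in_cyclotomic_class_0: "1 \<in> cyclotomic_class g k 0"
  unfolding cyclotomic_class_0 by (rule range_eqI[of _ _ 0]) simp

lemma cyclotomic_class_0_nonzero:
  "mult_generator g \<Longrightarrow> 0 \<notin> cyclotomic_class g k 0"
  by (auto simp: cyclotomic_class_0 mult_generator_nonzero)

section \<open>Maps with two multipliers and the Moebius count\<close>

lemma inj_two_multipliers_iff:
  fixes u v :: "'a::field"
  assumes "0 \<notin> H" "1 \<in> H" "\<And>x y. x \<in> H \<Longrightarrow> y \<in> H \<Longrightarrow> x * y \<in> H" "z \<noteq> 0" "z \<notin> H"
  shows "inj (\<lambda>x. if x \<in> H then u * x else v * x) \<longleftrightarrow> u / v \<in> H"
proof
  assume inj: "inj (\<lambda>x. if x \<in> H then u * x else v * x)"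
  \<comment> \<open>Otherwise the nonzero point \<open>z\<close> outside \<open>H\<close> would
    collide with \<open>0\<close>.\<close>
  have "v \<noteq> 0"
    using injD[OF inj, of z 0] assms by auto
  moreover have "u \<noteq> 0"
    using injD[OF inj, of 1 0] assms(1,2) by auto
  \<comment> \<open>Outside \<open>H\<close> the point \<open>u / v\<close> is sent to
    \<open>v * (u / v) = u\<close>, which is also the image of \<open>1\<close>.\<close>
  ultimately have "u / v = 1" if "u / v \<notin> H"
    using injD[OF inj, of "u / v" 1] assms(2) that by simp
  then show "u / v \<in> H"
    using assms(2) by metis
next
  assume t: "u / v \<in> H"
  then have nz: "u \<noteq> 0" "v \<noteq> 0"
    using assms(1) by auto
  \<comment> \<open>Excludes a collision between a point of \<open>H\<close> and one outside; on
    each side separately the map is multiplication by a nonzero constant.\<close>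
  have "y \<in> H" if "x \<in> H" "u * x = v * y" for x y
  proof -
    have "y = u / v * x"
      using that nz by (simp add: field_simps)
    then show ?thesis
      using assms(3)[OF t that(1)] by simp
  qed
  then show "inj (\<lambda>x. if x \<in> H then u * x else v * x)"
    using nz unfolding inj_on_def by (metis mult_cancel_left)
qed

text \<open>The value \<open>1\<close> is never taken because \<open>a \<noteq> b\<close>, which
  costs one element of \<open>H\<close>. The inverse map comes from solving
  \<open>(a - c) / (b - c) = s\<close> for \<open>c\<close>.\<close>

lemma card_moebius_preimage:
  fixes a b :: "'a::field"
  assumes "finite H" "0 \<notin> H" "1 \<in> H" "a \<noteq> b"
  shows "card {c. (a - c) / (b - c) \<in> H} = card H - 1"
proof -
  have "bij_betw (\<lambda>c. (a - c) / (b - c)) {c. (a - c) / (b - c) \<in> H} (H - {1})"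
  proof (rule bij_betwI[where g = "\<lambda>s. (a - s * b) / (1 - s)"])
    show "(\<lambda>c. (a - c) / (b - c)) \<in> {c. (a - c) / (b - c) \<in> H} \<rightarrow> H - {1}"
      using assms(4) by (auto simp: divide_eq_1_iff)
  next
    have inv: "(a - (a - s * b) / (1 - s)) / (b - (a - s * b) / (1 - s)) = s" if "s \<noteq> 1" for s
    proof -
      have "a - (a - s * b) / (1 - s) = s * (b - a) / (1 - s)"
        "b - (a - s * b) / (1 - s) = (b - a) / (1 - s)"
        using that by (auto simp: divide_simps) (auto simp: algebra_simps)
      then show ?thesis
        using that assms(4) by simp
    qed
    then show "(\<lambda>s. (a - s * b) / (1 - s)) \<in> H - {1} \<rightarrow> {c. (a - c) / (b - c) \<in> H}"
      by auto
    show "(a - (a - s * b) / (1 - s)) / (b - (a - s * b) / (1 - s)) = s" if "s \<in> H - {1}" for s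
      using inv that by blast
  next
    fix c assume "c \<in> {c. (a - c) / (b - c) \<in> H}"
    \<comment> \<open>At \<open>c = b\<close> division by zero yields \<open>0\<close>, which is not
      in \<open>H\<close>, so the pole lies outside the preimage.\<close>
    then have "b - c \<noteq> 0"
      using assms(2) by auto
    then have "a - (a - c) / (b - c) * b = c * (b - a) / (b - c)"
      "1 - (a - c) / (b - c) = (b - a) / (b - c)"
      by (auto simp: divide_simps) (auto simp: algebra_simps)
    then show "(a - (a - c) / (b - c) * b) / (1 - (a - c) / (b - c)) = c"
      using \<open>b - c \<noteq> 0\<close> assms(4) by simp
  qed
  then show ?thesis
    using assms(1,3) by (simp add: bij_betw_same_card)
qed

section \<open>Linear and near-linear orthomorphisms as explicit maps\<close>

lemma bij_mult_iff:
  fixes c :: "'a::field"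
  shows "bij (\<lambda>x. c * x) \<longleftrightarrow> c \<noteq> 0"
proof
  assume "bij (\<lambda>x. c * x)"
  then show "c \<noteq> 0"
    by (metis bij_is_inj injD mult_zero_left zero_neq_one)
next
  assume "c \<noteq> 0"
  then show "bij (\<lambda>x. c * x)"
    by (intro bij_betwI[where g = "\<lambda>x. x / c"]) auto
qed

lemma orthomorphism_mult_iff: "orthomorphism (\<lambda>x. c * x) \<longleftrightarrow> c \<noteq> 0 \<and> c \<noteq> 1"
proof -
  have "(\<lambda>x. c * x - x) = (\<lambda>x. (c - 1) * x)"
    by (simp add: algebra_simps)
  then show ?thesis
    unfolding orthomorphism_def by (simp add: bij_mult_iff)
qed

lemma linear_orthos_eq:
  assumes "mult_generator g"
  shows "linear_orthos g = (\<lambda>c x. c * x) ` (UNIV - {0, 1})"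
proof -
  have C1: "cyclotomic_class g 1 0 = UNIV - {0}"
    using assms unfolding cyclotomic_class_0 mult_generator_def by simp
  have "(\<exists>a. is_cyclotomic_map g 1 a \<phi>) \<longleftrightarrow> (\<exists>c. \<phi> = (\<lambda>x. c * x))" for \<phi>
  proof
    assume "\<exists>a. is_cyclotomic_map g 1 a \<phi>"
    then obtain a where "is_cyclotomic_map g 1 a \<phi>" ..
    then have "\<phi> 0 = 0" "\<forall>x\<in>UNIV - {0}. \<phi> x = a 0 * x"
      using C1 unfolding is_cyclotomic_map_def by auto
    then have "\<phi> x = a 0 * x" for x
      by (cases "x = 0") auto
    then show "\<exists>c. \<phi> = (\<lambda>x. c * x)"
      by blast
  next
    assume "\<exists>c. \<phi> = (\<lambda>x. c * x)"
    then obtain c where "\<phi> = (\<lambda>x. c * x)" ..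
    then show "\<exists>a. is_cyclotomic_map g 1 a \<phi>"
      unfolding is_cyclotomic_map_def by (intro exI[of _ "\<lambda>_. c"]) simp
  qed
  then show ?thesis
    unfolding linear_orthos_def cyc_orthos_def by (auto simp: orthomorphism_mult_iff)
qed

text \<open>Every nonzero element is some \<open>g ^ j\<close> and lies in the class of
  \<open>j mod k\<close>; all classes but that of index 0 share a multiplier. At \<open>0\<close>
  both branches give \<open>0\<close>.\<close>

lemma near_linear_two_multipliers:
  fixes g :: "'a::{field,finite}"
  assumes "mult_generator g" "near_linear g k \<theta>"
  obtains a b where "a \<noteq> b"
    "\<theta> = (\<lambda>x. if x \<in> cyclotomic_class g k 0 then a * x else b * x)"
proof -
  obtain m where k: "2 \<le> k" and m: "is_cyclotomic_map g k m \<theta>" "m 0 \<noteq> m 1" "\<forall>i\<in>{1..<k}. m i = m 1"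
    using assms(2) unfolding near_linear_def by blast
  have "\<theta> x = (if x \<in> cyclotomic_class g k 0 then m 0 * x else m 1 * x)" for x
  proof (cases "x \<in> cyclotomic_class g k 0 \<or> x = 0")
    case True
    then show ?thesis
      using m(1) k unfolding is_cyclotomic_map_def by auto
  next
    case False
    then have "x \<in> range (\<lambda>j. g ^ j)"
      using assms(1) unfolding mult_generator_def by simp
    then obtain j where j: "x = g ^ j"
      by blast
    then have x: "x \<in> cyclotomic_class g k (j mod k)"
      unfolding cyclotomic_class_def by (auto simp: cong_def)
    then have "j mod k \<noteq> 0"
      using False by metis
    moreover have "j mod k < k"
      using k by simp
    ultimately have "\<theta> x = m (j mod k) * x" "m (j mod k) = m 1"
      using m(1) x bspec[OF m(3), of "j mod k"] unfolding is_cyclotomic_map_def by auto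
    then show ?thesis
      using False by simp
  qed
  then show thesis
    using that m(2) by blast
qed

theorem theorem4p9:
  fixes g :: "'a::{field,finite}" and \<theta> :: "'a \<Rightarrow> 'a" and d q :: nat
  assumes "q = CARD('a)"
    and "d \<ge> 2"
    and "[q = 1] (mod d)"
    and "mult_generator g"
    and "\<theta> \<in> primitive_cyc_orthos g d"
    and "near_linear g d \<theta>"
  shows "real (card {\<phi> \<in> linear_orthos g. orthogonal_orthos \<theta> \<phi>})
           = (real q - 3 * real d - 1) / real d"
proof -
  define H where "H = cyclotomic_class g d 0"
  have pos: "0 < q - 1"
    using finite_field_card_minus_1_pos[where 'a = 'a] assms(1) by simp
  obtain n where n: "q - 1 = d * n"
    using cong_to_1_nat[OF assms(3)] by (auto elim: dvdE)
  have cardH: "card H = n"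
    unfolding H_def using card_cyclotomic_class_0 assms(1,4) n by blast
  \<comment> \<open>Here \<open>d \<ge> 2\<close> enters: \<open>H\<close> misses some nonzero
    \<open>z\<close>, the witness that \<open>inj_two_multipliers_iff\<close> requires.\<close>
  have "n < q - 1"
    using n pos assms(2) n_less_m_mult_n[of n d] by simp
  then have "\<not> UNIV - {0} \<subseteq> H"
    using card_mono[of H "UNIV - {0}"] cardH assms(1) by (auto simp: card_Diff_singleton)
  then obtain z where z: "z \<noteq> 0" "z \<notin> H"
    by blast
  have H: "0 \<notin> H" "1 \<in> H"
    unfolding H_def using cyclotomic_class_0_nonzero assms(4) one_in_cyclotomic_class_0 by blast+
  obtain a b where ab: "a \<noteq> b" and \<theta>: "\<theta> = (\<lambda>x. if x \<in> H then a * x else b * x)"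
    using near_linear_two_multipliers[OF assms(4,6)] unfolding H_def by blast
  define S where "S = {c. (a - c) / (b - c) \<in> H}"
  have bij_iff: "bij (\<lambda>x. \<theta> x - c * x) \<longleftrightarrow> c \<in> S" for c
  proof -
    have "(\<lambda>x. \<theta> x - c * x) = (\<lambda>x. if x \<in> H then (a - c) * x else (b - c) * x)"
      by (auto simp: \<theta> algebra_simps)
    then have "inj (\<lambda>x. \<theta> x - c * x) \<longleftrightarrow> c \<in> S"
      unfolding S_def
      using inj_two_multipliers_iff[OF H cyclotomic_class_0_mult_closed[of _ g d, folded H_def] z]
      by simp
    then show ?thesis
      using finite_UNIV_inj_surj[OF finite, of "\<lambda>x. \<theta> x - c * x"] unfolding bij_def by blast
  qed
  have ortho: "orthomorphism \<theta>"
    using assms(5) unfolding primitive_cyc_orthos_def cyc_orthos_def by blast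
  \<comment> \<open>The cases \<open>c = 0\<close> and \<open>c = 1\<close> are the two bijectivity
    conditions that make \<open>\<theta>\<close> an orthomorphism.\<close>
  then have S01: "{0, 1} \<subseteq> S"
    using bij_iff[of 0] bij_iff[of 1] unfolding orthomorphism_def by simp
  have "{\<phi> \<in> linear_orthos g. orthogonal_orthos \<theta> \<phi>} = (\<lambda>c x. c * x) ` (S - {0, 1})"
    using ortho
    by (auto simp: linear_orthos_eq[OF assms(4)] orthogonal_orthos_def orthomorphism_mult_iff bij_iff)
  moreover have "inj_on (\<lambda>(c::'a) x. c * x) (S - {0, 1})"
  proof (rule inj_onI)
    fix c c' :: 'a assume "(\<lambda>x. c * x) = (\<lambda>x. c' * x)"
    from fun_cong[OF this, of 1] show "c = c'"
      by simp
  qed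
  ultimately have "card {\<phi> \<in> linear_orthos g. orthogonal_orthos \<theta> \<phi>} = card (S - {0, 1})"
    by (simp add: card_image)
  moreover have "card S = n - 1"
    using card_moebius_preimage[OF _ H ab] cardH unfolding S_def by simp
  \<comment> \<open>This gives \<open>2 \<le> n - 1\<close>, so the truncated subtractions are exact
    and the count becomes \<open>real n - 3\<close>.\<close>
  moreover have "card {0, 1::'a} \<le> card S"
    using S01 by (intro card_mono) auto
  moreover have "card (S - {0, 1}) = card S - card {0, 1::'a}"
    using S01 by (intro card_Diff_subset) auto
  ultimately have "real (card {\<phi> \<in> linear_orthos g. orthogonal_orthos \<theta> \<phi>}) = real n - 3"
    by simp
  moreover have "real q = 1 + real d * real n"
  proof -
    have "q = 1 + d * n"
      using n pos by linarith
    then show ?thesis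
      by simp
  qed
  ultimately show ?thesis
    using assms(2) by (simp add: diff_divide_distrib)
qed

end
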